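(* Let $\mathfrak{A}$ be a residuated lattice. The following assertions are equivalent: (1) $\mathfrak{A}$ is Gelfand; (2) the hull-kernel topology and the $\mathscr{D}$-topology on $Spec(\mathfrak{A})$ coincide on $Max(\mathfrak{A})$ (that is, they induce the same subspace topology on $Max(\mathfrak{A})$).
   Context: A residuated lattice is an algebra $\mathfrak{A}=(A;\vee,\wedge,\odot,\rightarrow,0,1)$ such that $(A;\vee,\wedge,0,1)$ is a bounded lattice, $(A;\odot,1)$ is a commutative monoid, and $x\odot y\le z$ iff $x\le y\rightarrow z$ for all $x,y,z\in A$. A filter of $\mathfrak{A}$ is a non-empty subset $F\subseteq A$ such that $x,y\in F$ implies $x\odot y\in F$, and $x\in F$, $y\in A$ imply $x\vee y\in F$. $F\veebar G$ is the filter generated by $F\cup G$. A filter is proper if it is not $A$; a maximal filter is a maximal element (under inclusion) among proper filters; a prime filter is a proper filter $\mathfrak{p}$ such that $x\vee y\in\mathfrak{p}$ implies $x\in\mathfrak{p}$ or $y\in\mathfrak{p}$. $Spec(\mathfrak{A})$ and $Max(\mathfrak{A})$ are the sets of prime and maximal filters; $Max(\mathfrak{A})\subseteq Spec(\mathfrak{A})$. $\mathfrak{A}$ is Gelfand if every prime filter is contained in a unique maximal filter. For $X\subseteq A$, $h(X)=\{\mathfrak{p}\in Spec(\mathfrak{A})\mid X\subseteq\mathfrak{p}\}$ and $d(X)=Spec(\mathfrak{A})\setminus h(X)$. The hull-kernel topology $\tau_h$ on $Spec(\mathfrak{A})$ has closed basis $\{h(\{x\})\mid x\in A\}$. For a filter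 $F$, $\sigma(F)$ is the intersection of all prime filters $\mathfrak{q}$ such that $\mathfrak{q}\subseteq\mathfrak{p}$ for some $\mathfrak{p}\in h(F)$ (an empty intersection is $A$); equivalently $\sigma(F)=\{a\in A\mid F\veebar a^{\perp}=A\}$, where $a^{\perp}=\{x\in A\mid x\vee a=1\}$. $F$ is pure if $\sigma(F)=F$; $\sigma(\mathfrak{A})$ is the set of pure filters. The $\mathscr{D}$-topology on $Spec(\mathfrak{A})$ is $\tau_{\mathscr{D}}=\{d(F)\mid F\in\sigma(\mathfrak{A})\}$. (The sets $d(F)$ with $F$ pure are exactly the subsets of $Spec(\mathfrak{A})$ that are open in $\tau_h$ and closed upwards under inclusion of prime filters.) *)

theory Defs
  imports "HOL-Analysis.Abstract_Topology"
begin

unbundle lattice_syntax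

text \<open>The algebra lives on a whole type: its carrier is \<^term>\<open>UNIV\<close>, and the constants 0 and 1
  are \<^term>\<open>bot\<close> and \<^term>\<open>top\<close>.  The one-element algebra is not excluded.\<close>

class residuated_lattice = bounded_lattice +
  fixes odot :: "'a \<Rightarrow> 'a \<Rightarrow> 'a"  (infixl "\<odot>" 70)
    and residuum :: "'a \<Rightarrow> 'a \<Rightarrow> 'a"  (infixr "\<rightharpoonup>" 60)
  assumes odot_comm_monoid: "comm_monoid (\<odot>) \<top>"
    and residuation: "x \<odot> y \<le> z \<longleftrightarrow> x \<le> y \<rightharpoonup> z"

definition rl_filter :: "'a::residuated_lattice set \<Rightarrow> bool" where
  "rl_filter F \<longleftrightarrow> F \<noteq> {} \<and> (\<forall>x\<in>F. \<forall>y\<in>F. x \<odot> y \<in> F) \<and> (\<forall>x\<in>F. \<forall>y. x \<squnion> y \<in> F)"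

definition proper_filter :: "'a::residuated_lattice set \<Rightarrow> bool" where
  "proper_filter F \<longleftrightarrow> rl_filter F \<and> F \<noteq> UNIV"

definition maximal_filter :: "'a::residuated_lattice set \<Rightarrow> bool" where
  "maximal_filter M \<longleftrightarrow> proper_filter M \<and> (\<forall>G. proper_filter G \<and> M \<subseteq> G \<longrightarrow> G = M)"

definition prime_filter :: "'a::residuated_lattice set \<Rightarrow> bool" where
  "prime_filter P \<longleftrightarrow> proper_filter P \<and> (\<forall>x y. x \<squnion> y \<in> P \<longrightarrow> x \<in> P \<or> y \<in> P)"

definition prime_spec :: "'a::residuated_lattice set set" where
  "prime_spec = {P. prime_filter P}"

definition max_spec :: "'a::residuated_lattice set set" where
  "max_spec = {M. maximal_filter M}"

definition gelfand :: "'a::residuated_lattice itself \<Rightarrow> bool" where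
  "gelfand _ \<longleftrightarrow> (\<forall>P \<in> (prime_spec :: 'a set set). \<exists>!M. M \<in> max_spec \<and> P \<subseteq> M)"

definition spec_h :: "'a::residuated_lattice set \<Rightarrow> 'a set set" where
  "spec_h X = {P \<in> prime_spec. X \<subseteq> P}"

definition spec_d :: "'a::residuated_lattice set \<Rightarrow> 'a set set" where
  "spec_d X = prime_spec - spec_h X"

text \<open>The sets \<^term>\<open>spec_h {x}\<close> form a basis of the closed sets, so the open sets are the
  unions of sets \<^term>\<open>spec_d {x}\<close>.\<close>

definition hull_kernel_topology :: "'a::residuated_lattice set topology" where
  "hull_kernel_topology = topology (arbitrary union_of (\<lambda>U. \<exists>x. U = spec_d {x}))"

definition sigma_filter :: "'a::residuated_lattice set \<Rightarrow> 'a set" where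
  "sigma_filter F = \<Inter> {Q \<in> prime_spec. \<exists>P \<in> spec_h F. Q \<subseteq> P}"

definition pure_filter :: "'a::residuated_lattice set \<Rightarrow> bool" where
  "pure_filter F \<longleftrightarrow> rl_filter F \<and> sigma_filter F = F"

definition D_topology :: "'a::residuated_lattice set topology" where
  "D_topology = topology (\<lambda>U. \<exists>F. pure_filter F \<and> U = spec_d F)"

text \<open>\<^const>\<open>topology\<close> is only meaningful on families that satisfy the axioms of a topology.
  The facts below establish this, so both topologies have exactly the intended open sets.\<close>

lemma filter_top:
  assumes "rl_filter F" shows "\<top> \<in> F"
proof -
  from assms obtain x where "x \<in> F" by (auto simp: rl_filter_def)
  with assms have "x \<squnion> \<top> \<in> F" unfolding rl_filter_def by blast
  then show ?thesis by simp
qed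

lemma filter_bot:
  assumes "rl_filter F" "\<bottom> \<in> F" shows "F = UNIV"
proof -
  have "\<bottom> \<squnion> y \<in> F" for y using assms unfolding rl_filter_def by blast
  then show ?thesis by auto
qed

lemma prime_sup_iff:
  assumes "P \<in> prime_spec" shows "x \<squnion> y \<in> P \<longleftrightarrow> x \<in> P \<or> y \<in> P"
proof
  show "x \<squnion> y \<in> P \<Longrightarrow> x \<in> P \<or> y \<in> P"
    using assms by (simp add: prime_spec_def prime_filter_def)
  have "u \<squnion> v \<in> P" if "u \<in> P" for u v
    using assms that by (simp add: prime_spec_def prime_filter_def proper_filter_def rl_filter_def)
  then show "x \<in> P \<or> y \<in> P \<Longrightarrow> x \<squnion> y \<in> P"
    by (metis sup_commute)
qed

lemma prime_specD:
  assumes "P \<in> prime_spec" shows "rl_filter P" "\<bottom> \<notin> P" "\<not> UNIV \<subseteq> P"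
proof -
  show "rl_filter P" and *: "\<not> UNIV \<subseteq> P"
    using assms unfolding prime_spec_def prime_filter_def proper_filter_def by blast+
  then show "\<bottom> \<notin> P" using filter_bot by blast
qed

lemma filter_Inter:
  assumes "\<And>P. P \<in> \<P> \<Longrightarrow> rl_filter P" shows "rl_filter (\<Inter>\<P>)"
proof -
  have "\<top> \<in> \<Inter>\<P>" using assms filter_top by blast
  then show ?thesis using assms unfolding rl_filter_def by blast
qed

lemma spec_d_iff: "P \<in> spec_d X \<longleftrightarrow> P \<in> prime_spec \<and> \<not> X \<subseteq> P"
  by (auto simp: spec_d_def spec_h_def)

lemma spec_d_Int: "spec_d X \<inter> spec_d Y = spec_d {x \<squnion> y | x y. x \<in> X \<and> y \<in> Y}"
proof (rule set_eqI)
  fix P :: "'a set"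
  have "\<not> X \<subseteq> P \<and> \<not> Y \<subseteq> P \<longleftrightarrow> \<not> {x \<squnion> y | x y. x \<in> X \<and> y \<in> Y} \<subseteq> P" if "P \<in> prime_spec"
    using prime_sup_iff[OF that] by blast
  then show "P \<in> spec_d X \<inter> spec_d Y \<longleftrightarrow> P \<in> spec_d {x \<squnion> y | x y. x \<in> X \<and> y \<in> Y}"
    by (auto simp only: spec_d_iff Int_iff)
qed

lemma spec_d_Union: "(\<Union>X\<in>\<X>. spec_d X) = spec_d (\<Union>\<X>)"
  by (simp add: set_eq_iff spec_d_iff Sup_le_iff)

lemma spec_d_Union_singletons: "spec_d X = (\<Union>x\<in>X. spec_d {x})"
  by (auto simp: spec_d_iff)

lemma union_of_spec_d:
  "(arbitrary union_of (\<lambda>U. \<exists>x. U = spec_d {x})) U \<longleftrightarrow> (\<exists>X. U = spec_d X)"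
proof
  assume "(arbitrary union_of (\<lambda>U. \<exists>x. U = spec_d {x})) U"
  then obtain \<U> where \<U>: "\<U> \<subseteq> {U. \<exists>x. U = spec_d {x}}" "\<Union>\<U> = U"
    by (auto simp: union_of_def)
  then have "U = spec_d {x. spec_d {x} \<in> \<U>}"
    by (subst spec_d_Union_singletons) blast
  then show "\<exists>X. U = spec_d X" ..
next
  assume "\<exists>X. U = spec_d X"
  then obtain X where "U = spec_d X" ..
  then have "U = \<Union>((\<lambda>x. spec_d {x}) ` X)"
    using spec_d_Union_singletons[of X] by (rule trans)
  then show "(arbitrary union_of (\<lambda>U. \<exists>x. U = spec_d {x})) U"
    unfolding union_of_def arbitrary_def
    by (intro exI[of _ "(\<lambda>x. spec_d {x}) ` X"]) auto
qed

lemma spec_d_Union_ex: "\<forall>K\<in>\<K>. \<exists>X. K = spec_d X \<Longrightarrow> \<exists>X. \<Union>\<K> = spec_d X"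
proof (rule exI[of _ "\<Union>{X. spec_d X \<in> \<K>}"])
  assume "\<forall>K\<in>\<K>. \<exists>X. K = spec_d X"
  then have "\<K> = spec_d ` {X. spec_d X \<in> \<K>}" by (auto simp: image_iff)
  then have "\<Union>\<K> = \<Union>(spec_d ` {X. spec_d X \<in> \<K>})" by (rule arg_cong)
  then show "\<Union>\<K> = spec_d (\<Union>{X. spec_d X \<in> \<K>})"
    using spec_d_Union by (rule trans)
qed

theorem openin_hull_kernel_topology:
  "openin hull_kernel_topology U \<longleftrightarrow> (arbitrary union_of (\<lambda>U. \<exists>x. U = spec_d {x})) U"
proof -
  have "istopology (\<lambda>U::'a set set. \<exists>X. U = spec_d X)"
    unfolding istopology_def
  proof (intro conjI allI impI)
    fix S T :: "'a set set" assume "\<exists>X. S = spec_d X" "\<exists>X. T = spec_d X"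
    then show "\<exists>X. S \<inter> T = spec_d X" by (elim exE) (simp add: spec_d_Int, blast)
  qed (rule spec_d_Union_ex)
  moreover have "(arbitrary union_of (\<lambda>U::'a set set. \<exists>x. U = spec_d {x})) = (\<lambda>U. \<exists>X. U = spec_d X)"
    by (rule ext) (rule union_of_spec_d)
  ultimately show ?thesis unfolding hull_kernel_topology_def
    by (simp add: topology_inverse')
qed

lemma pure_spec_d_iff:
  "(\<exists>F. pure_filter F \<and> U = spec_d F) \<longleftrightarrow>
   (\<exists>X. U = spec_d X) \<and> (\<forall>P\<in>U. \<forall>Q\<in>prime_spec. P \<subseteq> Q \<longrightarrow> Q \<in> U)"
proof
  assume "\<exists>F. pure_filter F \<and> U = spec_d F"
  then obtain F where F: "sigma_filter F = F" "U = spec_d F"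
    unfolding pure_filter_def by (elim exE conjE) (rule that)
  have "Q \<in> U" if P: "P \<in> U" and Q: "Q \<in> prime_spec" and "P \<subseteq> Q" for P Q
  proof (rule ccontr)
    assume "Q \<notin> U"
    then have "Q \<in> spec_h F" using Q by (simp add: F(2) spec_d_def)
    moreover have "P \<in> prime_spec" using P by (simp add: F(2) spec_d_iff)
    ultimately have "sigma_filter F \<subseteq> P"
      unfolding sigma_filter_def using \<open>P \<subseteq> Q\<close> by (intro Inter_lower) blast
    then show False using P by (simp add: F spec_d_iff)
  qed
  then have "\<forall>P\<in>U. \<forall>Q\<in>prime_spec. P \<subseteq> Q \<longrightarrow> Q \<in> U" by blast
  with F(2) show "(\<exists>X. U = spec_d X) \<and> (\<forall>P\<in>U. \<forall>Q\<in>prime_spec. P \<subseteq> Q \<longrightarrow> Q \<in> U)"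
    by (intro conjI exI)
next
  assume R: "(\<exists>X. U = spec_d X) \<and> (\<forall>P\<in>U. \<forall>Q\<in>prime_spec. P \<subseteq> Q \<longrightarrow> Q \<in> U)"
  then obtain X where X: "U = spec_d X" by (elim conjE exE)
  define F where "F = \<Inter>(prime_spec - U)"
  have "X \<subseteq> F" unfolding F_def X spec_d_def spec_h_def by blast
  then have "P \<notin> U" if "P \<in> spec_h F" for P
    using that unfolding X spec_d_def spec_h_def by blast
  moreover have "F \<subseteq> P" if "P \<in> prime_spec - U" for P
    unfolding F_def using that by (rule Inter_lower)
  ultimately have hF: "spec_h F = prime_spec - U"
    unfolding spec_h_def by blast
  have "{Q \<in> prime_spec. \<exists>P \<in> spec_h F. Q \<subseteq> P} = prime_spec - U"
    unfolding hF using R by blast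
  then have "sigma_filter F = F" by (simp add: sigma_filter_def F_def)
  moreover have "rl_filter F" unfolding F_def
    by (rule filter_Inter) (blast dest: prime_specD(1))
  moreover have "U = spec_d F"
    using X hF unfolding spec_d_def by blast
  ultimately show "\<exists>F. pure_filter F \<and> U = spec_d F"
    unfolding pure_filter_def by (intro exI conjI)
qed

theorem openin_D_topology:
  "openin D_topology U \<longleftrightarrow> (\<exists>F. pure_filter F \<and> U = spec_d F)"
proof -
  let ?L = "\<lambda>U::'a set set. (\<exists>X. U = spec_d X) \<and> (\<forall>P\<in>U. \<forall>Q\<in>prime_spec. P \<subseteq> Q \<longrightarrow> Q \<in> U)"
  have "istopology ?L"
    unfolding istopology_def
  proof (intro conjI allI impI)
    fix S T :: "'a set set" assume "?L S" "?L T"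
    then show "\<exists>X. S \<inter> T = spec_d X" by (elim exE conjE) (simp add: spec_d_Int, blast)
    show "\<forall>P\<in>S \<inter> T. \<forall>Q\<in>prime_spec. P \<subseteq> Q \<longrightarrow> Q \<in> S \<inter> T" using \<open>?L S\<close> \<open>?L T\<close> by blast
  next
    fix \<K> :: "'a set set set" assume K: "\<forall>K\<in>\<K>. ?L K"
    then show "\<exists>X. \<Union>\<K> = spec_d X" by (intro spec_d_Union_ex) blast
    show "\<forall>P\<in>\<Union>\<K>. \<forall>Q\<in>prime_spec. P \<subseteq> Q \<longrightarrow> Q \<in> \<Union>\<K>" using K by blast
  qed
  moreover have "(\<lambda>U::'a set set. \<exists>F. pure_filter F \<and> U = spec_d F) = ?L"
    by (rule ext) (rule pure_spec_d_iff)
  ultimately have "istopology (\<lambda>U::'a set set. \<exists>F. pure_filter F \<and> U = spec_d F)"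
    by (simp only:)
  then show ?thesis unfolding D_topology_def by (simp only: topology_inverse')
qed

theorem topspace_hull_kernel_topology: "topspace hull_kernel_topology = prime_spec"
proof -
  have "spec_d {\<bottom>} = (prime_spec :: 'a set set)"
    by (rule set_eqI) (auto simp: spec_d_iff dest: prime_specD)
  then have "openin hull_kernel_topology (prime_spec :: 'a set set)"
    unfolding openin_hull_kernel_topology union_of_spec_d by metis
  moreover have "U \<subseteq> prime_spec" if "openin hull_kernel_topology U" for U :: "'a set set"
    using that unfolding openin_hull_kernel_topology union_of_spec_d by (auto simp: spec_d_iff)
  ultimately show ?thesis by (meson openin_subset openin_topspace subset_antisym)
qed

theorem topspace_D_topology: "topspace D_topology = prime_spec"
proof -
  have "spec_d UNIV = (prime_spec :: 'a set set)"
    by (rule set_eqI) (auto simp: spec_d_iff dest: prime_specD)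
  then have "openin D_topology (prime_spec :: 'a set set)"
    unfolding openin_D_topology pure_spec_d_iff by blast
  moreover have "U \<subseteq> prime_spec" if "openin D_topology U" for U :: "'a set set"
    using that unfolding openin_D_topology by (auto simp: spec_d_iff)
  ultimately show ?thesis by (meson openin_subset openin_topspace subset_antisym)
qed

end

theory Submission
  imports Defs
begin

text \<open>Open sets of the hull-kernel topology are closed downwards under inclusion, and those of the
  \<open>D\<close>-topology are in addition closed upwards.

  If the two topologies agree on the maximal filters and a prime filter \<open>P\<close> lies below two maximal
  filters \<open>M\<close> and \<open>N\<close>, then separating \<open>M\<close> from \<open>N\<close> by a \<open>D\<close>-open set is impossible: such a set
  passes from \<open>M\<close> down to \<open>P\<close> and from there up to \<open>N\<close>.  As distinct maximal filters are incomparable,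
  the hull-kernel topology does separate them, so \<open>M = N\<close>.

  Conversely, in the Gelfand case every prime filter \<open>P\<close> has a unique maximal filter \<open>m P\<close> above it.
  The set of all \<open>P\<close> with \<open>x \<notin> m P\<close> is closed upwards and has the same trace on the maximal
  filters as \<^term>\<open>spec_d {x}\<close>; what has to be shown is that it is hull-kernel open (lemma
  \<open>gelfand_open_retract\<close>; topologically, \<open>m\<close> is continuous).  Given a maximal filter
  \<open>M\<close> not containing \<open>x\<close>, consider the filter of all \<open>b\<close> with \<open>a \<squnion> b = \<top>\<close> for some \<open>a \<notin> M\<close>.
  A maximal filter that contains this filter shares a prime subfilter with \<open>M\<close>
  (lemma \<open>prime_below_both\<close>), hence is \<open>M\<close>.  So this filter and \<open>x\<close> generate
  the whole algebra, and already one of its elements \<open>b\<close> does so together with \<open>x\<close>.  With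
  \<open>a \<squnion> b = \<top>\<close> and \<open>a \<notin> M\<close>, every prime filter that omits \<open>a\<close> contains \<open>b\<close>, so no proper filter
  above it contains \<open>x\<close>: the set \<^term>\<open>spec_d {a}\<close> is the required neighbourhood.\<close>

section \<open>Filters of residuated lattices\<close>

lemma odot_commute: "x \<odot> y = y \<odot> (x::'a::residuated_lattice)"
  using odot_comm_monoid by (metis comm_monoid.axioms(1) abel_semigroup.commute comm_monoid_def)

lemma odot_top: "x \<odot> \<top> = (x::'a::residuated_lattice)"
  using odot_comm_monoid by (metis comm_monoid.comm_neutral)

lemma odot_mono:
  fixes x y z :: "'a::residuated_lattice"
  assumes "x \<le> y" shows "x \<odot> z \<le> y \<odot> z"
  using assms by (meson order_refl order_trans residuation)

lemma odot_le_left: "x \<odot> y \<le> (x::'a::residuated_lattice)"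
  by (metis odot_commute odot_mono odot_top top_greatest)

lemma sup_odot_le:
  fixes a b c :: "'a::residuated_lattice"
  assumes "a \<odot> c \<le> d" "b \<odot> c \<le> d" shows "(a \<squnion> b) \<odot> c \<le> d"
  using assms by (simp add: residuation)

lemma sup_odot_sup_le: "(a \<squnion> c) \<odot> (b \<squnion> c) \<le> a \<odot> b \<squnion> (c::'a::residuated_lattice)"
proof (rule sup_odot_le)
  have c: "c \<odot> y \<le> a \<odot> b \<squnion> c" for y
    by (meson odot_le_left order_trans sup_ge2)
  then show "c \<odot> (b \<squnion> c) \<le> a \<odot> b \<squnion> c" .
  have "b \<odot> a \<le> a \<odot> b \<squnion> c"
    by (subst odot_commute) (rule sup_ge1)
  then have "(b \<squnion> c) \<odot> a \<le> a \<odot> b \<squnion> c"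
    using c by (rule sup_odot_le)
  then show "a \<odot> (b \<squnion> c) \<le> a \<odot> b \<squnion> c"
    by (subst odot_commute)
qed

lemma filter_upward:
  assumes "rl_filter F" "x \<in> F" "x \<le> y" shows "y \<in> F"
  using assms unfolding rl_filter_def by (metis sup.absorb2)

lemma filter_odot:
  assumes "rl_filter F" "x \<in> F" "y \<in> F" shows "x \<odot> y \<in> F"
  using assms unfolding rl_filter_def by blast

lemma filter_odot_iff:
  assumes "rl_filter F" shows "x \<odot> y \<in> F \<longleftrightarrow> x \<in> F \<and> y \<in> F"
  using assms by (metis filter_odot filter_upward odot_commute odot_le_left)

lemma rl_filterI:
  assumes "\<top> \<in> F"
    and "\<And>x y. x \<in> F \<Longrightarrow> y \<in> F \<Longrightarrow> x \<odot> y \<in> F"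
    and "\<And>x y. x \<in> F \<Longrightarrow> x \<le> y \<Longrightarrow> y \<in> F"
  shows "rl_filter F"
  unfolding rl_filter_def
proof (intro conjI ballI allI)
  show "x \<squnion> y \<in> F" if "x \<in> F" for x y
    using that sup_ge1 by (rule assms(3))
qed (use assms(1,2) in auto)

lemma proper_filter_iff: "proper_filter F \<longleftrightarrow> rl_filter F \<and> \<bottom> \<notin> F"
  unfolding proper_filter_def using filter_bot by blast

lemma filter_singleton_top: "rl_filter {\<top> :: 'a::residuated_lattice}"
  by (rule rl_filterI) (simp_all add: odot_top top_unique)

text \<open>Arguments about joins usually pass to generated filters and then compare powers of their
  elements.  The quotient filters give the same conclusions without powers; that they are filters
  is the inequality \<open>(a \<squnion> c) \<odot> (b \<squnion> c) \<le> a \<odot> b \<squnion> c\<close>.\<close>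

lemma filter_sup_quotient:
  assumes "rl_filter F" shows "rl_filter {w. w \<squnion> c \<in> F}"
proof (rule rl_filterI)
  show "\<top> \<in> {w. w \<squnion> c \<in> F}" using filter_top[OF assms] by simp
  show "x \<odot> y \<in> {w. w \<squnion> c \<in> F}"
    if "x \<in> {w. w \<squnion> c \<in> F}" "y \<in> {w. w \<squnion> c \<in> F}" for x y
    using that filter_upward[OF assms filter_odot[OF assms] sup_odot_sup_le] by simp
  show "y \<in> {w. w \<squnion> c \<in> F}" if "x \<in> {w. w \<squnion> c \<in> F}" "x \<le> y" for x y
    using that filter_upward[OF assms, of "x \<squnion> c" "y \<squnion> c"] by (simp add: le_supI1)
qed

section \<open>Existence of prime and maximal filters\<close>

lemma maximal_disjoint_filter_exists:
  assumes "rl_filter F" "F \<inter> S = {}"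
  obtains P where "rl_filter P" "F \<subseteq> P" "P \<inter> S = {}"
    "\<forall>G. rl_filter G \<and> P \<subseteq> G \<and> G \<inter> S = {} \<longrightarrow> G = P"
proof -
  let ?A = "{P. rl_filter P \<and> F \<subseteq> P \<and> P \<inter> S = {}}"
  have "\<exists>P\<in>?A. \<forall>G\<in>?A. P \<subseteq> G \<longrightarrow> G = P"
  proof (rule subset_Zorn_nonempty)
    show "?A \<noteq> {}" using assms by blast
  next
    fix \<C> assume "\<C> \<noteq> {}" and chain: "subset.chain ?A \<C>"
    then have C: "rl_filter P" "F \<subseteq> P" "P \<inter> S = {}" if "P \<in> \<C>" for P
      using that unfolding subset_chain_def by blast+
    have "rl_filter (\<Union>\<C>)"
    proof (rule rl_filterI)
      show "\<top> \<in> \<Union>\<C>" using \<open>\<C> \<noteq> {}\<close> C(1) filter_top by blast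
      show "x \<odot> y \<in> \<Union>\<C>" if "x \<in> \<Union>\<C>" "y \<in> \<Union>\<C>" for x y
      proof -
        obtain P Q where PQ: "P \<in> \<C>" "x \<in> P" "Q \<in> \<C>" "y \<in> Q"
          using \<open>x \<in> \<Union>\<C>\<close> \<open>y \<in> \<Union>\<C>\<close> by (elim UnionE)
        moreover have "P \<subseteq> Q \<or> Q \<subseteq> P"
          using chain PQ(1,3) unfolding subset_chain_def by (elim conjE) (drule (1) bspec)+
        ultimately obtain R where "R \<in> \<C>" "x \<in> R" "y \<in> R" by blast
        then show ?thesis using filter_odot[OF C(1)] by blast
      qed
      show "y \<in> \<Union>\<C>" if "x \<in> \<Union>\<C>" "x \<le> y" for x y
        using that filter_upward[OF C(1)] by blast
    qed
    then show "\<Union>\<C> \<in> ?A" using \<open>\<C> \<noteq> {}\<close> C(2,3) by blast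
  qed
  then obtain P where P: "P \<in> ?A" and max: "\<forall>G\<in>?A. P \<subseteq> G \<longrightarrow> G = P" by (rule bexE)
  have "\<forall>G. rl_filter G \<and> P \<subseteq> G \<and> G \<inter> S = {} \<longrightarrow> G = P"
  proof (intro allI impI)
    fix G assume G: "rl_filter G \<and> P \<subseteq> G \<and> G \<inter> S = {}"
    then have "G \<in> ?A" using P by blast
    then show "G = P" using max G by blast
  qed
  with P show ?thesis by (intro that[of P]) simp_all
qed

text \<open>Let \<open>x \<squnion> y \<in> P\<close> with \<open>x\<close> and \<open>y\<close> outside \<open>P\<close>.  The filter of all \<open>w\<close> with \<open>w \<squnion> y \<in> P\<close> contains \<open>P\<close>
  and \<open>x\<close>, so by maximality it meets \<open>S\<close>: some \<open>s \<in> S\<close> can replace \<open>x\<close>.  In the same way some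
  \<open>t \<in> S\<close> then replaces \<open>y\<close>, and \<open>t \<squnion> s\<close> lies in both \<open>P\<close> and \<open>S\<close>.\<close>

lemma maximal_disjoint_filter_prime:
  assumes P: "rl_filter P" and disj: "P \<inter> S = {}"
    and max: "\<forall>G. rl_filter G \<and> P \<subseteq> G \<and> G \<inter> S = {} \<longrightarrow> G = P"
    and "S \<noteq> {}" and S_sup: "\<And>s t. s \<in> S \<Longrightarrow> t \<in> S \<Longrightarrow> s \<squnion> t \<in> S"
  shows "prime_filter P"
proof -
  have enlarge: "\<exists>s\<in>S. s \<squnion> c \<in> P" if "w \<squnion> c \<in> P" "w \<notin> P" for w c
  proof (rule ccontr)
    assume "\<not> ?thesis"
    then have "{w. w \<squnion> c \<in> P} \<inter> S = {}" by blast
    moreover have "P \<subseteq> {w. w \<squnion> c \<in> P}" using filter_upward[OF P] sup_ge1 by blast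
    ultimately have "{w. w \<squnion> c \<in> P} = P" using max filter_sup_quotient[OF P] by blast
    then show False using that by blast
  qed
  have "x \<in> P \<or> y \<in> P" if xy: "x \<squnion> y \<in> P" for x y
  proof (rule ccontr)
    assume "\<not> (x \<in> P \<or> y \<in> P)"
    then obtain s where s: "s \<in> S" "y \<squnion> s \<in> P"
      using enlarge[OF xy] by (auto simp: sup_commute)
    then obtain t where "t \<in> S" "t \<squnion> s \<in> P"
      using enlarge[OF s(2)] \<open>\<not> (x \<in> P \<or> y \<in> P)\<close> by blast
    then show False using S_sup s(1) disj by blast
  qed
  moreover have "P \<noteq> UNIV" using \<open>S \<noteq> {}\<close> disj by blast
  ultimately show ?thesis unfolding prime_filter_def proper_filter_def using P by blast
qed

lemma maximal_filter_above:
  assumes "proper_filter F"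
  obtains M where "M \<in> max_spec" "F \<subseteq> M"
proof -
  have "rl_filter F" "F \<inter> {\<bottom>} = {}" using assms by (simp_all add: proper_filter_iff)
  then obtain M where M: "rl_filter M" "F \<subseteq> M" "M \<inter> {\<bottom>} = {}"
    "\<forall>G. rl_filter G \<and> M \<subseteq> G \<and> G \<inter> {\<bottom>} = {} \<longrightarrow> G = M"
    by (rule maximal_disjoint_filter_exists)
  then have "M \<in> max_spec"
    by (simp add: max_spec_def maximal_filter_def proper_filter_iff)
  then show ?thesis using M(2) by (rule that)
qed

text \<open>Maximal filters are the filters that are maximal among those disjoint from \<open>{\<bottom>}\<close>, and \<open>{\<bottom>}\<close>
  is closed under joins.\<close>

lemma max_spec_subset_prime_spec: "max_spec \<subseteq> prime_spec"
proof
  fix M :: "'a set" assume "M \<in> max_spec"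
  then have M: "rl_filter M" "M \<inter> {\<bottom>} = {}"
    "\<forall>G. rl_filter G \<and> M \<subseteq> G \<and> G \<inter> {\<bottom>} = {} \<longrightarrow> G = M"
    unfolding max_spec_def maximal_filter_def proper_filter_iff by blast+
  have "prime_filter M"
    by (rule maximal_disjoint_filter_prime[OF M]) simp_all
  then show "M \<in> prime_spec" by (simp add: prime_spec_def)
qed

lemma max_spec_eqI:
  assumes "M \<in> max_spec" "N \<in> max_spec" "M \<subseteq> N" shows "M = N"
  using assms by (auto simp: max_spec_def maximal_filter_def)

text \<open>The joins \<open>a \<squnion> b\<close> with \<open>a \<notin> M\<close> and \<open>b \<notin> N\<close> form a set closed under joins that avoids \<open>\<top>\<close>.
  A prime filter disjoint from it lies in both \<open>M\<close> and \<open>N\<close>.\<close>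

lemma prime_below_both:
  assumes M: "M \<in> prime_spec" and N: "N \<in> prime_spec"
    and avoid: "\<And>a b. a \<notin> M \<Longrightarrow> b \<notin> N \<Longrightarrow> a \<squnion> b \<noteq> \<top>"
  obtains P where "P \<in> prime_spec" "P \<subseteq> M" "P \<subseteq> N"
proof -
  define S where "S = {a \<squnion> b | a b. a \<notin> M \<and> b \<notin> N}"
  have "{\<top>} \<inter> S = {}" using avoid by (force simp: S_def)
  with filter_singleton_top obtain P where P: "rl_filter P" "{\<top>} \<subseteq> P" "P \<inter> S = {}"
    "\<forall>G. rl_filter G \<and> P \<subseteq> G \<and> G \<inter> S = {} \<longrightarrow> G = P"
    by (rule maximal_disjoint_filter_exists)
  have S_sup: "s \<squnion> t \<in> S" if st_in: "s \<in> S" "t \<in> S" for s t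
  proof -
    obtain a b c d where st: "s = a \<squnion> b" "t = c \<squnion> d" "a \<notin> M" "b \<notin> N" "c \<notin> M" "d \<notin> N"
      using st_in unfolding S_def by blast
    then have "s \<squnion> t = (a \<squnion> c) \<squnion> (b \<squnion> d)" by (simp add: ac_simps)
    moreover have "a \<squnion> c \<notin> M" "b \<squnion> d \<notin> N"
      using st by (simp_all add: prime_sup_iff[OF M] prime_sup_iff[OF N])
    ultimately show ?thesis unfolding S_def by blast
  qed
  have bot: "\<bottom> \<notin> M" "\<bottom> \<notin> N" using M N prime_specD(2) by blast+
  have in_S: "a \<squnion> b \<in> S" if "a \<notin> M" "b \<notin> N" for a b using that unfolding S_def by blast
  have "S \<noteq> {}" using in_S bot by blast
  then have "P \<in> prime_spec"
    using maximal_disjoint_filter_prime[OF P(1,3,4)] S_sup by (simp add: prime_spec_def)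
  moreover have "P \<subseteq> M"
  proof
    show "p \<in> M" if "p \<in> P" for p using in_S[of p \<bottom>] that bot(2) P(3) by auto
  qed
  moreover have "P \<subseteq> N"
  proof
    show "p \<in> N" if "p \<in> P" for p using in_S[of \<bottom> p] that bot(1) P(3) by auto
  qed
  ultimately show ?thesis by (rule that)
qed

section \<open>The two topologies on maximal filters\<close>

lemma gelfand_unique:
  assumes "gelfand TYPE('a::residuated_lattice)" "(P :: 'a set) \<in> prime_spec"
    "M \<in> max_spec" "P \<subseteq> M" "N \<in> max_spec" "P \<subseteq> N"
  shows "M = N"
proof -
  have "\<exists>!M. M \<in> max_spec \<and> P \<subseteq> M"
    using assms(1)[unfolded gelfand_def] assms(2) by (rule bspec)
  moreover have "M \<in> max_spec \<and> P \<subseteq> M" "N \<in> max_spec \<and> P \<subseteq> N" using assms(3-6) by simp_all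
  ultimately show ?thesis by (elim ex1E) (metis (no_types))
qed

text \<open>The filter \<open>B\<close> below collects the \<open>b\<close> that can be separated from \<open>M\<close>, and \<open>G\<close> is the filter
  generated by \<open>B\<close> and \<open>x\<close>, written as the directed union over \<open>b \<in> B\<close> of the filters generated by
  \<open>b\<close> and \<open>x\<close>.  This form provides a single \<open>b\<close> as soon as \<open>\<bottom> \<in> G\<close>.\<close>

lemma gelfand_separation:
  fixes x :: "'a::residuated_lattice"
  assumes gelfand: "gelfand TYPE('a)" and M: "M \<in> max_spec" and "x \<notin> M"
  obtains a b where "a \<notin> M" "a \<squnion> b = \<top>"
    "\<forall>H. rl_filter H \<and> b \<in> H \<and> x \<in> H \<longrightarrow> \<bottom> \<in> H"
proof -
  have prime: "M \<in> prime_spec" using M max_spec_subset_prime_spec by blast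
  define B where "B = {b. \<exists>a. a \<notin> M \<and> a \<squnion> b = \<top>}"
  have B: "rl_filter B"
  proof (rule rl_filterI)
    show "\<top> \<in> B" using prime_specD(2)[OF prime] by (auto simp: B_def)
    show "b \<odot> b' \<in> B" if bs: "b \<in> B" "b' \<in> B" for b b'
    proof -
      obtain a a' where a: "a \<notin> M" "a' \<notin> M" "a \<squnion> b = \<top>" "a' \<squnion> b' = \<top>"
        using bs unfolding B_def by blast
      \<comment> \<open>The common witness \<open>a \<squnion> a'\<close> puts \<open>b\<close> and \<open>b'\<close> into one quotient filter of \<open>{\<top>}\<close>.\<close>
      let ?c = "a \<squnion> a'"
      have "b \<squnion> ?c = (a \<squnion> b) \<squnion> a'" "b' \<squnion> ?c = (a' \<squnion> b') \<squnion> a"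
        by (simp_all only: ac_simps)
      then have "b \<in> {w. w \<squnion> ?c \<in> {\<top>}}" "b' \<in> {w. w \<squnion> ?c \<in> {\<top>}}"
        by (simp_all add: a)
      then have "b \<odot> b' \<in> {w. w \<squnion> ?c \<in> {\<top>}}"
        by (rule filter_odot[OF filter_sup_quotient[OF filter_singleton_top]])
      then have "?c \<squnion> b \<odot> b' = \<top>" by (simp add: sup_commute)
      moreover have "?c \<notin> M" using a prime_sup_iff[OF prime] by blast
      ultimately show ?thesis unfolding B_def by blast
    qed
    show "b' \<in> B" if "b \<in> B" "b \<le> b'" for b b'
    proof -
      obtain a where "a \<notin> M" "a \<squnion> b = \<top>" using \<open>b \<in> B\<close> unfolding B_def by blast
      moreover have "a \<squnion> b \<le> a \<squnion> b'" using \<open>b \<le> b'\<close> by (rule sup_mono[OF order_refl])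
      ultimately show ?thesis unfolding B_def by (auto simp: top_unique)
    qed
  qed
  define G where "G = {z. \<exists>b\<in>B. \<forall>H. rl_filter H \<and> b \<in> H \<and> x \<in> H \<longrightarrow> z \<in> H}"
  have G: "rl_filter G"
  proof (rule rl_filterI)
    show "\<top> \<in> G" using filter_top[OF B] unfolding G_def by blast
    show "y \<odot> z \<in> G" if yz: "y \<in> G" "z \<in> G" for y z
    proof -
      obtain b c where bc: "b \<in> B" "c \<in> B"
        "\<And>H. rl_filter H \<Longrightarrow> b \<in> H \<Longrightarrow> x \<in> H \<Longrightarrow> y \<in> H"
        "\<And>H. rl_filter H \<Longrightarrow> c \<in> H \<Longrightarrow> x \<in> H \<Longrightarrow> z \<in> H"
        using yz unfolding G_def by blast
      have "y \<odot> z \<in> H" if "rl_filter H" "b \<odot> c \<in> H" "x \<in> H" for H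
        using that bc(3,4) by (simp add: filter_odot_iff)
      then show ?thesis using filter_odot[OF B bc(1,2)] unfolding G_def by blast
    qed
    show "z \<in> G" if "y \<in> G" "y \<le> z" for y z
      using that unfolding G_def by (blast intro: filter_upward)
  qed
  have "\<bottom> \<in> G"
  proof (rule ccontr)
    assume "\<bottom> \<notin> G"
    then have "proper_filter G" using G by (simp add: proper_filter_iff)
    then obtain N where N: "N \<in> max_spec" "G \<subseteq> N" by (rule maximal_filter_above)
    \<comment> \<open>Any element of \<open>B\<close> serves to show \<open>x \<in> G\<close>; \<open>\<top>\<close> is one.\<close>
    have "x \<in> N" using filter_top[OF B] N(2) unfolding G_def by blast
    have "B \<subseteq> N" using N(2) unfolding G_def by blast
    then have avoid: "a \<squnion> b \<noteq> \<top>" if "a \<notin> M" "b \<notin> N" for a b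
      using that unfolding B_def by blast
    have "N \<in> prime_spec" using N(1) max_spec_subset_prime_spec by blast
    with prime obtain P where "P \<in> prime_spec" "P \<subseteq> M" "P \<subseteq> N"
      using avoid by (rule prime_below_both)
    then have "M = N" using gelfand_unique[OF gelfand] M N(1) by blast
    then show False using \<open>x \<in> N\<close> \<open>x \<notin> M\<close> by blast
  qed
  then show ?thesis unfolding G_def B_def using that by blast
qed

text \<open>In the Gelfand case the set below is the preimage of \<^term>\<open>spec_d {x}\<close> under the map sending
  a prime filter to the maximal filter above it.\<close>

lemma gelfand_open_retract:
  fixes x :: "'a::residuated_lattice"
  assumes gelfand: "gelfand TYPE('a)"
  shows "openin D_topology {P \<in> prime_spec. \<forall>M\<in>max_spec. P \<subseteq> M \<longrightarrow> x \<notin> M}"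
    (is "openin _ ?V")
proof -
  have nbhd: "\<exists>a. P \<in> spec_d {a} \<and> spec_d {a} \<subseteq> ?V" if P: "P \<in> ?V" for P
  proof -
    have "proper_filter P" using P by (simp add: prime_spec_def prime_filter_def)
    then obtain M where M: "M \<in> max_spec" "P \<subseteq> M" by (rule maximal_filter_above)
    have "x \<notin> M" using P M by blast
    obtain a b where ab: "a \<notin> M" "a \<squnion> b = \<top>"
      "\<forall>H. rl_filter H \<and> b \<in> H \<and> x \<in> H \<longrightarrow> \<bottom> \<in> H"
      using gelfand M(1) \<open>x \<notin> M\<close> by (rule gelfand_separation)
    have "x \<notin> N" if Q: "Q \<in> spec_d {a}" and N: "N \<in> max_spec" "Q \<subseteq> N" for Q N
    proof
      assume "x \<in> N"
      have Q': "Q \<in> prime_spec" "a \<notin> Q" using Q by (simp_all add: spec_d_iff)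
      have "a \<squnion> b \<in> Q"
        unfolding ab(2) using prime_specD(1)[OF Q'(1)] by (rule filter_top)
      then have "b \<in> N" using prime_sup_iff[OF Q'(1)] Q'(2) N(2) by blast
      have "N \<in> prime_spec" using N(1) max_spec_subset_prime_spec by (rule rev_subsetD)
      then have "rl_filter N" "\<bottom> \<notin> N" by (rule prime_specD)+
      then show False using ab(3) \<open>b \<in> N\<close> \<open>x \<in> N\<close> by blast
    qed
    then have "spec_d {a} \<subseteq> ?V" by (auto simp: spec_d_iff)
    moreover have "P \<in> spec_d {a}" using P ab(1) M(2) by (auto simp: spec_d_iff)
    ultimately show ?thesis by blast
  qed
  have "?V = spec_d {a. spec_d {a} \<subseteq> ?V}"
  proof (rule set_eqI, rule iffI)
    fix P assume "P \<in> ?V"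
    then obtain a where "P \<in> spec_d {a}" "spec_d {a} \<subseteq> ?V" by (elim nbhd[THEN exE] conjE)
    then show "P \<in> spec_d {a. spec_d {a} \<subseteq> ?V}"
      by (subst spec_d_Union_singletons) (rule UN_I[of a], simp_all only: mem_Collect_eq)
  next
    fix P assume "P \<in> spec_d {a. spec_d {a} \<subseteq> ?V}"
    then obtain a where "spec_d {a} \<subseteq> ?V" "P \<in> spec_d {a}"
      by (subst (asm) spec_d_Union_singletons) (elim UN_E CollectE)
    then show "P \<in> ?V" by (rule subsetD)
  qed
  moreover have "\<forall>P\<in>?V. \<forall>Q\<in>prime_spec. P \<subseteq> Q \<longrightarrow> Q \<in> ?V" by auto
  ultimately show ?thesis unfolding openin_D_topology pure_spec_d_iff by (intro conjI exI)
qed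

lemma openin_hull_kernel_iff: "openin hull_kernel_topology U \<longleftrightarrow> (\<exists>X. U = spec_d X)"
  by (simp only: openin_hull_kernel_topology union_of_spec_d)

lemma openin_D_iff:
  "openin D_topology U \<longleftrightarrow>
    openin hull_kernel_topology U \<and> (\<forall>P\<in>U. \<forall>Q\<in>prime_spec. P \<subseteq> Q \<longrightarrow> Q \<in> U)"
  by (simp only: openin_D_topology pure_spec_d_iff openin_hull_kernel_iff)

lemma gelfand_imp_subtopology_eq:
  assumes gelfand: "gelfand TYPE('a::residuated_lattice)"
  shows "subtopology (hull_kernel_topology :: 'a set topology) max_spec =
    subtopology D_topology max_spec"
proof -
  let ?D = "subtopology (D_topology :: 'a set topology) max_spec"
  have basic: "openin ?D (spec_d {x} \<inter> max_spec)" for x :: 'a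
  proof -
    let ?V = "{P \<in> prime_spec. \<forall>M\<in>max_spec. P \<subseteq> M \<longrightarrow> x \<notin> M}"
    have "spec_d {x} \<inter> max_spec = ?V \<inter> max_spec"
    proof (rule set_eqI)
      show "N \<in> spec_d {x} \<inter> max_spec \<longleftrightarrow> N \<in> ?V \<inter> max_spec" for N
        using max_spec_eqI[of N] by (auto simp: spec_d_iff)
    qed
    then show ?thesis
      unfolding openin_subtopology using gelfand_open_retract[OF gelfand] by blast
  qed
  have hull_D: "openin ?D (U \<inter> max_spec)" if U: "openin hull_kernel_topology U" for U :: "'a set set"
  proof -
    obtain X where "U = spec_d X" using U unfolding openin_hull_kernel_iff by blast
    then have eq: "U \<inter> max_spec = (\<Union>x\<in>X. spec_d {x} \<inter> max_spec)"
      using spec_d_Union_singletons[of X] by blast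
    show ?thesis unfolding eq by (rule openin_Union) (use basic in auto)
  qed
  show ?thesis
    unfolding topology_eq
  proof (intro allI iffI)
    fix T :: "'a set set"
    show "openin ?D T" if "openin (subtopology hull_kernel_topology max_spec) T"
      using that hull_D unfolding openin_subtopology[of hull_kernel_topology] by blast
    show "openin (subtopology hull_kernel_topology max_spec) T" if "openin ?D T"
      using that unfolding openin_subtopology openin_D_iff by blast
  qed
qed

lemma subtopology_eq_imp_gelfand:
  assumes eq: "subtopology (hull_kernel_topology :: 'a::residuated_lattice set topology) max_spec =
    subtopology D_topology max_spec"
  shows "gelfand TYPE('a)"
proof -
  have unique: "M = N"
    if P: "P \<in> prime_spec" and M: "M \<in> max_spec" "P \<subseteq> M" and N: "N \<in> max_spec" "P \<subseteq> N"
    for P M N :: "'a set"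
  proof (rule ccontr)
    assume "M \<noteq> N"
    then obtain x where x: "x \<in> N" "x \<notin> M" using max_spec_eqI[OF N(1) M(1)] by blast
    have "openin (subtopology hull_kernel_topology max_spec) (spec_d {x} \<inter> max_spec)"
      unfolding openin_subtopology openin_hull_kernel_iff by blast
    then obtain U where U: "openin D_topology U" "spec_d {x} \<inter> max_spec = U \<inter> max_spec"
      unfolding eq openin_subtopology by blast
    obtain F where F: "U = spec_d F"
      using U(1) unfolding openin_D_topology by blast
    have "M \<in> spec_d {x} \<inter> max_spec"
      using x(2) M(1) max_spec_subset_prime_spec by (auto simp: spec_d_iff)
    then have "M \<in> U" using U(2) by blast
    then have "P \<in> U" using P M(2) by (auto simp: F spec_d_iff)
    then have "N \<in> U"
      using U(1) N max_spec_subset_prime_spec unfolding openin_D_iff by blast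
    then have "N \<in> spec_d {x}" using U(2) N(1) by blast
    then show False using x(1) by (simp add: spec_d_iff)
  qed
  show ?thesis
    unfolding gelfand_def
  proof
    fix P :: "'a set" assume P: "P \<in> prime_spec"
    then have "proper_filter P" by (simp add: prime_spec_def prime_filter_def)
    then obtain M where "M \<in> max_spec" "P \<subseteq> M" by (rule maximal_filter_above)
    then show "\<exists>!M. M \<in> max_spec \<and> P \<subseteq> M" using unique[OF P] by blast
  qed
qed

theorem theorem4p15:
  shows "gelfand TYPE('a::residuated_lattice) \<longleftrightarrow>
    subtopology (hull_kernel_topology :: 'a set topology) max_spec =
    subtopology (D_topology :: 'a set topology) max_spec"
  using gelfand_imp_subtopology_eq subtopology_eq_imp_gelfand by (rule iffI)

end
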